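(* Let $e$ be a program expression, $s$ a frame store, $h,h'$ heaps and $v$ a value such that $s;\,h;\,[\,]\vdash e\Downarrow v;\,h'$ is derivable (starting from the empty function closure), and suppose every function called in $e$ is defined inside $e$ via a $\mathsf{letfun}$ construct. Then for every context $\Gamma$, signature $\Sigma$ and zero-order type $\tau$ such that $\mathsf{True};\,\Gamma\vdash_\Sigma e:\tau$ is derivable, and for every size valuation $\epsilon$ and type instantiation $\eta$, the following holds: if for every $z\in FV(e)$ there is $w$ with $s(z)\models^{h}_{\eta(\epsilon(\Gamma(z)))} w$, then there is $w'$ with $v\models^{h'}_{\eta(\epsilon(\tau))} w'$.
   Context: Language. Program variables are $z$ (generic), $x,y$ (integer), $l,hd,tl$ (lists); $c$ ranges over integer constants, $\mathsf{binop}\in\{+,-,\mathsf{div},\mathsf{mod}\}$, $f$ over function names. Basic expressions $b::= c\mid x\,\mathsf{binop}\,y\mid \mathsf{nil}\mid \mathsf{cons}(z,l)\mid f(z_1,\dots,z_n)$. Expressions $e::= b\mid \mathsf{let}\ z=b\ \mathsf{in}\ e_1\mid \mathsf{if}\ x\ \mathsf{then}\ e_1\ \mathsf{else}\ e_2\mid \mathsf{match}\ l\ \mathsf{with}\ \mathsf{nil}\Rightarrow e_1\mid \mathsf{cons}(hd,tl)\Rightarrow e_2\mid \mathsf{letfun}\ f(z_1,\dots,z_n)=e_1\ \mathsf{in}\ e_2\mid \mathsf{letextern}\ f(z_1,\dots,z_n)\ \mathsf{in}\ e_1$, where in $\mathsf{letfun}$ one requires $FV(e_1)\subseteq\{z_1,\dots,z_n\}$.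 $FV(e)$ is the set of free program variables ($\mathsf{let}$ binds $z$ in its body, $\mathsf{match}$ binds $hd,tl$ in the cons-branch). Types. Size expressions $p$ are polynomials with rational coefficients in size variables (which stand for natural numbers). Zero-order types: $\tau::=\mathtt{Int}\mid\alpha\mid[\tau]^{p}$ ($\alpha$ a type variable; $[\tau]^p$ = lists of length $p$ with elements of type $\tau$). A ground type has no size or type variables. $D$ denotes a finite conjunction of polynomial equations; $D\vdash p=q$ means: for all assignments of natural numbers to the size variables satisfying $D$, $p=q$. $D\vdash\tau=\tau'$ holds iff either $\tau=\tau'=\mathtt{Int}$ or $\tau=\tau'=\alpha$, or $\tau=[\tau'']^{p}$, $\tau'=[\tau''']^{p'}$ have the same underlying type (annotations erased), $D\vdash p=p'$, and ($D\vdash p=0$ or $D\vdash\tau''=\tau'''$). A first-order type is $\tau^\circ_1\times\dots\times\tau^\circ_n\to\tau_{n+1}$ where all annotations in the $\tau^\circ_i$ are size variables and the size variables of $\tau_{n+1}$ occur in the $\tau^\circ_i$. A context $\Gamma$ maps program variables to zero-order types ($\Gamma,z:\tau$ is its extension); a signature $\Sigma$ maps function names to first-order types. Typing rules for $D;\Gamma\vdash_\Sigma e:\tau$: (IConst) $D;\Gamma\vdash c:\mathtt{Int}$. (IBinop) $D;\Gamma,x:\mathtt{Int},y:\mathtt{Int}\vdash x\,\mathsf{binop}\,y:\mathtt{Int}$. (Nil) if $D\vdash p=0$ then $D;\Gamma\vdash\mathsf{nil}:[\tau]^p$. (Var) if $D\vdash\tau=\tau'$ then $D;\Gamma,z:\tau\vdash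 z:\tau'$. (Cons) if $D\vdash p=p'+1$ then $D;\Gamma,hd:\tau,tl:[\tau]^{p'}\vdash\mathsf{cons}(hd,tl):[\tau]^p$. (If) from $D;\Gamma,x:\mathtt{Int}\vdash e_t:\tau$ and $D;\Gamma,x:\mathtt{Int}\vdash e_f:\tau$ infer $D;\Gamma,x:\mathtt{Int}\vdash \mathsf{if}\ x\ \mathsf{then}\ e_t\ \mathsf{else}\ e_f:\tau$. (Let) if $z\notin\mathrm{dom}\,\Gamma$, $D;\Gamma\vdash e_1:\tau_z$ and $D;\Gamma,z:\tau_z\vdash e_2:\tau$ then $D;\Gamma\vdash\mathsf{let}\ z=e_1\ \mathsf{in}\ e_2:\tau$. (Match) if $hd,tl\notin\mathrm{dom}\,\Gamma$, $(p=0\wedge D);\Gamma,l:[\tau']^p\vdash e_{nil}:\tau$ and $D;\Gamma,hd:\tau',l:[\tau']^p,tl:[\tau']^{p-1}\vdash e_{cons}:\tau$, then $D;\Gamma,l:[\tau']^p\vdash \mathsf{match}\ l\ \mathsf{with}\ \mathsf{nil}\Rightarrow e_{nil}\mid\mathsf{cons}(hd,tl)\Rightarrow e_{cons}:\tau$. (LetFun) if $\Sigma(f)=\tau^\circ_1\times\dots\times\tau^\circ_n\to\tau_{n+1}$, $\mathsf{True};z_1:\tau^\circ_1,\dots,z_n:\tau^\circ_n\vdash_\Sigma e_1:\tau_{n+1}$ and $D;\Gamma\vdash_\Sigma e_2:\tau'$, then $D;\Gamma\vdash_\Sigma\mathsf{letfun}\ f(z_1,\dots,z_n)=e_1\ \mathsf{in}\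 e_2:\tau'$. (LetExtern) if $\Sigma(f)$ is a first-order type and $D;\Gamma\vdash_\Sigma e:\tau'$ then $D;\Gamma\vdash_\Sigma\mathsf{letextern}\ f(z_1,\dots,z_n)\ \mathsf{in}\ e:\tau'$. (FunApp) if $\Sigma(f)=\tau^\circ_1\times\dots\times\tau^\circ_n\to\tau_{n+1}$, $\langle *,C\rangle=\Theta(\tau^\circ_1\times\dots\times\tau^\circ_n,\ \tau'_1\times\dots\times\tau'_n)$, $D\vdash\tau'_{n+1}=*(\tau_{n+1})$ and $D\vdash C$, then $D;\Gamma,z_1:\tau'_1,\dots,z_n:\tau'_n\vdash f(z_1,\dots,z_n):\tau'_{n+1}$. Here $\Theta$ matches each formal type $\tau^\circ_i$ position-wise against the actual type $\tau'_i$; $*$ substitutes for each type variable the matched type and for each size variable a matched size expression, and $C$ is the set of equations $p=p'$ for all pairs of size expressions matched with the same size variable. Heaps and semantics of types. Values $v::=c\mid\ell\mid\mathtt{NULL}$ ($\ell$ a location). A heap $h$ is a finite partial map from locations to partial maps $\{\mathtt{hd},\mathtt{tl}\}\rightharpoonup$ values; $h.\ell.\mathtt{hd}$, $h.\ell.\mathtt{tl}$ are the stored values, $h[\ell.\mathtt{hd}:=v_1,\ell.\mathtt{tl}:=v_2]$ is the update, $h|_X$ is restriction to a set $X$ of locations, and $h\setminus\ell$ is $h$ with $\ell$ removed from its domain. The relation $v\models^h_{\tau}w$ ($\tau$ ground) is defined by: $c\models^h_{\mathtt{Int}}c$; $\mathtt{NULL}\models^h_{[\tau]^0}[\,]$;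 $\ell\models^h_{[\tau]^{n}}w_{hd}::w_{tl}$ iff $n\ge1$ is a natural number, $\ell\in\mathrm{dom}\,h$, $h.\ell.\mathtt{hd}\models^{h\setminus\ell}_{\tau}w_{hd}$ and $h.\ell.\mathtt{tl}\models^{h\setminus\ell}_{[\tau]^{n-1}}w_{tl}$; nothing else holds. The footprint is $R(h,c)=R(h,\mathtt{NULL})=\emptyset$, $R(h,\ell)=\emptyset$ if $\ell\notin\mathrm{dom}\,h$, and otherwise $R(h,\ell)=\{\ell\}\cup R(h\setminus\ell,h.\ell.\mathtt{hd})\cup R(h\setminus\ell,h.\ell.\mathtt{tl})$; for a store $s$, $R(h,s)=\bigcup_{z\in\mathrm{dom}\,s}R(h,s(z))$. Operational semantics. A frame store $s$ is a finite partial map from program variables to values; a closure $\mathcal C$ maps function names to pairs (parameter list, body). Judgement $s;h;\mathcal C\vdash e\Downarrow v;h'$: $c\Downarrow c;h$; $x\,\mathsf{binop}\,y\Downarrow s(x)\,\mathsf{binop}\,s(y);h$; $\mathsf{nil}\Downarrow\mathtt{NULL};h$; $z\Downarrow s(z);h$; $\mathsf{cons}(hd,tl)\Downarrow\ell;h[\ell.\mathtt{hd}:=s(hd),\ell.\mathtt{tl}:=s(tl)]$ for some $\ell\notin\mathrm{dom}\,h$; $\mathsf{if}\ x\ldots$ evaluates $e_1$ if $s(x)\neq0$ and $e_2$ if $s(x)=0$ (same $s,h,\mathcal C$); $\mathsf{let}\ z=e_1\ \mathsf{in}\ e_2\Downarrow v;h'$ if $s;h;\mathcal C\vdash e_1\Downarrow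 v_1;h_1$, $s[z:=v_1];h_1;\mathcal C\vdash e_2\Downarrow v;h'$ and $h|_{R(h,s|_{FV(e_2)})}=h_1|_{R(h,s|_{FV(e_2)})}$; $\mathsf{match}$ evaluates $e_1$ in $s;h;\mathcal C$ if $s(l)=\mathtt{NULL}$, and otherwise evaluates $e_2$ in $s[hd:=h.s(l).\mathtt{hd},tl:=h.s(l).\mathtt{tl}];h;\mathcal C$; $\mathsf{letfun}\ f(z_1..z_n)=e_1\ \mathsf{in}\ e_2$ evaluates $e_2$ in $s;h;\mathcal C[f:=((z_1,..,z_n),e_1)]$; $f(z_1,\dots,z_n)\Downarrow v;h'$ if $\mathcal C(f)=((z'_1,\dots,z'_n),e_f)$, $FV(e_f)\subseteq\{z'_i\}$ and $[z'_1:=s(z_1),\dots,z'_n:=s(z_n)];h;\mathcal C\vdash e_f\Downarrow v;h'$. There is no rule for $\mathsf{letextern}$ (the external environment is empty). A size valuation $\epsilon$ maps size variables to natural numbers and a type instantiation $\eta$ maps type variables to ground types; $\eta(\epsilon(\cdot))$ applies both to all variables in a type or context. *)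

theory Defs
  imports Complex_Main "HOL-Library.Poly_Mapping" "HOL-Library.Finite_Map"
begin

type_synonym var = string
type_synonym fname = string
type_synonym svar = string
type_synonym tvar = string

section \<open>Language\<close>

datatype binop = Plus | Minus | Div | Mod

text \<open>A program variable is itself an expression (it has its own typing and evaluation
  rule), so it is included among the basic expressions.\<close>

datatype basic =
    Const int
  | Binop var binop var
  | ENil
  | ECons var var
  | Var var
  | App fname "var list"

datatype exp =
    Basic basic
  | LetIn var basic exp
  | IfThenElse var exp exp
  | Match var exp var var exp  \<comment> \<open>list variable, nil branch, head, tail, cons branch\<close>
  | LetFun fname "var list" exp exp
  | LetExtern fname "var list" exp

primrec FVb :: "basic \<Rightarrow> var set" where
  "FVb (Const c) = {}"
| "FVb (Binop x bop y) = {x, y}"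
| "FVb ENil = {}"
| "FVb (ECons z l) = {z, l}"
| "FVb (Var z) = {z}"
| "FVb (App f zs) = set zs"

primrec FV :: "exp \<Rightarrow> var set" where
  "FV (Basic b) = FVb b"
| "FV (LetIn z b e) = FVb b \<union> (FV e - {z})"
| "FV (IfThenElse x e1 e2) = {x} \<union> FV e1 \<union> FV e2"
| "FV (Match l e1 zh zt e2) = {l} \<union> FV e1 \<union> (FV e2 - {zh, zt})"
| "FV (LetFun f zs e1 e2) = (FV e1 - set zs) \<union> FV e2"
| "FV (LetExtern f zs e) = FV e"

primrec wf_exp :: "exp \<Rightarrow> bool" where
  "wf_exp (Basic b) \<longleftrightarrow> True"
| "wf_exp (LetIn z b e) \<longleftrightarrow> wf_exp e"
| "wf_exp (IfThenElse x e1 e2) \<longleftrightarrow> wf_exp e1 \<and> wf_exp e2"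
| "wf_exp (Match l e1 zh zt e2) \<longleftrightarrow> wf_exp e1 \<and> wf_exp e2"
| "wf_exp (LetFun f zs e1 e2) \<longleftrightarrow> FV e1 \<subseteq> set zs \<and> wf_exp e1 \<and> wf_exp e2"
| "wf_exp (LetExtern f zs e) \<longleftrightarrow> wf_exp e"

primrec called_b :: "basic \<Rightarrow> fname set" where
  "called_b (Const c) = {}"
| "called_b (Binop x bop y) = {}"
| "called_b ENil = {}"
| "called_b (ECons z l) = {}"
| "called_b (Var z) = {}"
| "called_b (App f zs) = {f}"

primrec called :: "exp \<Rightarrow> fname set" where
  "called (Basic b) = called_b b"
| "called (LetIn z b e) = called_b b \<union> called e"
| "called (IfThenElse x e1 e2) = called e1 \<union> called e2"
| "called (Match l e1 zh zt e2) = called e1 \<union> called e2"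
| "called (LetFun f zs e1 e2) = called e1 \<union> called e2"
| "called (LetExtern f zs e) = called e"

primrec letfun_defined :: "exp \<Rightarrow> fname set" where
  "letfun_defined (Basic b) = {}"
| "letfun_defined (LetIn z b e) = letfun_defined e"
| "letfun_defined (IfThenElse x e1 e2) = letfun_defined e1 \<union> letfun_defined e2"
| "letfun_defined (Match l e1 zh zt e2) = letfun_defined e1 \<union> letfun_defined e2"
| "letfun_defined (LetFun f zs e1 e2) = insert f (letfun_defined e1 \<union> letfun_defined e2)"
| "letfun_defined (LetExtern f zs e) = letfun_defined e"

section \<open>Size expressions\<close>

text \<open>Multivariate polynomials: monomials are finitely supported exponent functions, and
  a polynomial is a finitely supported coefficient function on monomials. The ring
  operations are those of \<^theory>\<open>HOL-Library.Poly_Mapping\<close>.\<close>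

type_synonym spoly = "(svar \<Rightarrow>\<^sub>0 nat) \<Rightarrow>\<^sub>0 rat"

definition pconst :: "rat \<Rightarrow> spoly" where
  "pconst c = Poly_Mapping.single 0 c"

definition pvar :: "svar \<Rightarrow> spoly" where
  "pvar n = Poly_Mapping.single (Poly_Mapping.single n 1) 1"

definition pvars :: "spoly \<Rightarrow> svar set" where
  "pvars p = (\<Union>m\<in>Poly_Mapping.keys p. Poly_Mapping.keys m)"

definition insertion :: "(rat \<Rightarrow> 'r) \<Rightarrow> (svar \<Rightarrow> 'r) \<Rightarrow> spoly \<Rightarrow> 'r::comm_ring_1" where
  "insertion emb \<nu> p =
     (\<Sum>m\<in>Poly_Mapping.keys p.
        emb (Poly_Mapping.lookup p m) *
        (\<Prod>n\<in>Poly_Mapping.keys m. \<nu> n ^ Poly_Mapping.lookup m n))"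

definition peval :: "(svar \<Rightarrow> nat) \<Rightarrow> spoly \<Rightarrow> rat" where
  "peval \<epsilon> = insertion (\<lambda>c. c) (\<lambda>n. of_nat (\<epsilon> n))"

definition psubst :: "(svar \<Rightarrow> spoly) \<Rightarrow> spoly \<Rightarrow> spoly" where
  "psubst \<sigma> = insertion pconst \<sigma>"

text \<open>A finite conjunction of equations is a list of pairs; \<open>True\<close> is the empty list.\<close>

type_synonym eqns = "(spoly \<times> spoly) list"

definition satisfies :: "(svar \<Rightarrow> nat) \<Rightarrow> eqns \<Rightarrow> bool" where
  "satisfies \<epsilon> D \<longleftrightarrow> (\<forall>(p, q)\<in>set D. peval \<epsilon> p = peval \<epsilon> q)"

definition entails :: "eqns \<Rightarrow> spoly \<Rightarrow> spoly \<Rightarrow> bool" where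
  "entails D p q \<longleftrightarrow> (\<forall>\<epsilon>. satisfies \<epsilon> D \<longrightarrow> peval \<epsilon> p = peval \<epsilon> q)"

section \<open>Types\<close>

text \<open>The type of annotations is a parameter: size polynomials for zero-order types,
  size variables for the argument types of first-order types.\<close>

datatype 'p ty = TInt | TVar tvar | TList "'p ty" 'p

type_synonym zty = "spoly ty"
type_synonym aty = "svar ty"
type_synonym foty = "aty list \<times> zty"
type_synonym ctxt = "var \<rightharpoonup> zty"
type_synonym sig = "fname \<rightharpoonup> foty"

abbreviation zty_of_aty :: "aty \<Rightarrow> zty" where
  "zty_of_aty \<equiv> map_ty pvar"

abbreviation underlying :: "'p ty \<Rightarrow> unit ty" where
  "underlying \<equiv> map_ty (\<lambda>_. ())"

definition first_order :: "foty \<Rightarrow> bool" where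
  "first_order ft \<longleftrightarrow>
     (case ft of (as, t) \<Rightarrow> (\<Union>p\<in>set_ty t. pvars p) \<subseteq> (\<Union>a\<in>set as. set_ty a))"

definition signature :: "sig \<Rightarrow> bool" where
  "signature \<Sigma> \<longleftrightarrow> (\<forall>ft\<in>ran \<Sigma>. first_order ft)"

fun ty_eq :: "eqns \<Rightarrow> zty \<Rightarrow> zty \<Rightarrow> bool" where
  "ty_eq D TInt TInt \<longleftrightarrow> True"
| "ty_eq D (TVar a) (TVar b) \<longleftrightarrow> a = b"
| "ty_eq D (TList t p) (TList t' p') \<longleftrightarrow>
     underlying t = underlying t' \<and> entails D p p' \<and> (entails D p 0 \<or> ty_eq D t t')"
| "ty_eq D _ _ \<longleftrightarrow> False"

primrec tsubst :: "(tvar \<Rightarrow> zty) \<Rightarrow> (svar \<Rightarrow> spoly) \<Rightarrow> zty \<Rightarrow> zty" where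
  "tsubst \<theta> \<sigma> TInt = TInt"
| "tsubst \<theta> \<sigma> (TVar a) = \<theta> a"
| "tsubst \<theta> \<sigma> (TList t p) = TList (tsubst \<theta> \<sigma> t) (psubst \<sigma> p)"

fun fits :: "aty \<Rightarrow> zty \<Rightarrow> bool" where
  "fits TInt TInt \<longleftrightarrow> True"
| "fits (TVar a) t \<longleftrightarrow> True"
| "fits (TList f n) (TList t p) \<longleftrightarrow> fits f t"
| "fits _ _ \<longleftrightarrow> False"

fun tvar_matches :: "aty \<Rightarrow> zty \<Rightarrow> (tvar \<times> zty) set" where
  "tvar_matches (TVar a) t = {(a, t)}"
| "tvar_matches (TList f n) (TList t p) = tvar_matches f t"
| "tvar_matches _ _ = {}"

fun svar_matches :: "aty \<Rightarrow> zty \<Rightarrow> (svar \<times> spoly) set" where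
  "svar_matches (TList f n) (TList t p) = insert (n, p) (svar_matches f t)"
| "svar_matches _ _ = {}"

text \<open>\<open>Theta fs ts \<theta> \<sigma> C\<close>: matching the formal types \<open>fs\<close> against the actual types \<open>ts\<close>
  yields the substitution \<open>\<theta>\<close>, \<open>\<sigma>\<close> of type and size variables and the equations \<open>C\<close>.
  All types matched with one type variable have to coincide; for a size variable any one
  of the matched polynomials may be chosen, as \<open>C\<close> equates them all. The substitution
  is the identity on unmatched variables.\<close>

definition Theta ::
  "aty list \<Rightarrow> zty list \<Rightarrow> (tvar \<Rightarrow> zty) \<Rightarrow> (svar \<Rightarrow> spoly) \<Rightarrow> (spoly \<times> spoly) set \<Rightarrow> bool" where
  "Theta fs ts \<theta> \<sigma> C \<longleftrightarrow>
     list_all2 fits fs ts \<and>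
     (let TM = (\<Union>(f, t)\<in>set (zip fs ts). tvar_matches f t);
          SM = (\<Union>(f, t)\<in>set (zip fs ts). svar_matches f t)
      in (\<forall>(a, t)\<in>TM. \<theta> a = t) \<and> (\<forall>a. a \<notin> Domain TM \<longrightarrow> \<theta> a = TVar a) \<and>
         (\<forall>n\<in>Domain SM. (n, \<sigma> n) \<in> SM) \<and> (\<forall>n. n \<notin> Domain SM \<longrightarrow> \<sigma> n = pvar n) \<and>
         C = {(p, q). \<exists>n. (n, p) \<in> SM \<and> (n, q) \<in> SM})"

section \<open>Typing rules\<close>

text \<open>A rule for a context of the form \<open>\<Gamma>, z : \<tau>\<close> is stated for a context \<open>\<Gamma>\<close> that maps
  \<open>z\<close> to \<open>\<tau>\<close>. Hence \<open>zh \<notin> dom \<Gamma>\<close> in the rule for \<open>Match\<close> includes \<open>zh \<noteq> l\<close>, and likewise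
  for \<open>zt\<close>.\<close>

inductive typing :: "sig \<Rightarrow> eqns \<Rightarrow> ctxt \<Rightarrow> exp \<Rightarrow> zty \<Rightarrow> bool" for \<Sigma> :: sig where
  T_IConst: "typing \<Sigma> D \<Gamma> (Basic (Const c)) TInt"
| T_IBinop: "\<Gamma> x = Some TInt \<Longrightarrow> \<Gamma> y = Some TInt \<Longrightarrow>
    typing \<Sigma> D \<Gamma> (Basic (Binop x bop y)) TInt"
| T_Nil: "entails D p 0 \<Longrightarrow> typing \<Sigma> D \<Gamma> (Basic ENil) (TList t p)"
| T_Var: "\<Gamma> z = Some t \<Longrightarrow> ty_eq D t t' \<Longrightarrow> typing \<Sigma> D \<Gamma> (Basic (Var z)) t'"
| T_Cons: "\<Gamma> zh = Some t \<Longrightarrow> \<Gamma> zt = Some (TList t p') \<Longrightarrow> entails D p (p' + 1) \<Longrightarrow>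
    typing \<Sigma> D \<Gamma> (Basic (ECons zh zt)) (TList t p)"
| T_If: "\<Gamma> x = Some TInt \<Longrightarrow> typing \<Sigma> D \<Gamma> e1 t \<Longrightarrow> typing \<Sigma> D \<Gamma> e2 t \<Longrightarrow>
    typing \<Sigma> D \<Gamma> (IfThenElse x e1 e2) t"
| T_Let: "z \<notin> dom \<Gamma> \<Longrightarrow> typing \<Sigma> D \<Gamma> (Basic b) tz \<Longrightarrow> typing \<Sigma> D (\<Gamma>(z \<mapsto> tz)) e t \<Longrightarrow>
    typing \<Sigma> D \<Gamma> (LetIn z b e) t"
| T_Match: "\<Gamma> l = Some (TList t' p) \<Longrightarrow> zh \<notin> dom \<Gamma> \<Longrightarrow> zt \<notin> dom \<Gamma> \<Longrightarrow> zh \<noteq> zt \<Longrightarrow>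
    typing \<Sigma> ((p, 0) # D) \<Gamma> e1 t \<Longrightarrow>
    typing \<Sigma> D (\<Gamma>(zh \<mapsto> t', zt \<mapsto> TList t' (p - 1))) e2 t \<Longrightarrow>
    typing \<Sigma> D \<Gamma> (Match l e1 zh zt e2) t"
| T_LetFun: "\<Sigma> f = Some (fs, t) \<Longrightarrow> length zs = length fs \<Longrightarrow> distinct zs \<Longrightarrow>
    typing \<Sigma> [] (map_of (zip zs (map zty_of_aty fs))) e1 t \<Longrightarrow>
    typing \<Sigma> D \<Gamma> e2 t' \<Longrightarrow>
    typing \<Sigma> D \<Gamma> (LetFun f zs e1 e2) t'"
| T_LetExtern: "\<Sigma> f = Some (fs, t) \<Longrightarrow> typing \<Sigma> D \<Gamma> e t' \<Longrightarrow>
    typing \<Sigma> D \<Gamma> (LetExtern f zs e) t'"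
| T_FunApp: "\<Sigma> f = Some (fs, t) \<Longrightarrow> map \<Gamma> zs = map Some ts \<Longrightarrow> Theta fs ts \<theta> \<sigma> C \<Longrightarrow>
    ty_eq D t' (tsubst \<theta> \<sigma> t) \<Longrightarrow> (\<forall>(p, q)\<in>C. entails D p q) \<Longrightarrow>
    typing \<Sigma> D \<Gamma> (Basic (App f zs)) t'"

section \<open>Heaps and semantics of types\<close>

type_synonym loc = nat

datatype val = VInt int | VLoc loc | VNull

datatype field = Hd | Tl

type_synonym cell = "field \<rightharpoonup> val"
type_synonym heap = "(loc, cell) fmap"
type_synonym store = "(var, val) fmap"

text \<open>A ground type has no type variables, and its annotations are constants.\<close>

datatype gty = GInt | GList gty rat

datatype sval = SInt int | SList "sval list"

inductive models :: "heap \<Rightarrow> val \<Rightarrow> gty \<Rightarrow> sval \<Rightarrow> bool" where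
  models_Int: "models h (VInt c) GInt (SInt c)"
| models_Null: "models h VNull (GList t 0) (SList [])"
| models_Loc: "n \<ge> 1 \<Longrightarrow> fmlookup h ll = Some cl \<Longrightarrow> cl Hd = Some v1 \<Longrightarrow> cl Tl = Some v2 \<Longrightarrow>
    models (fmdrop ll h) v1 t w1 \<Longrightarrow>
    models (fmdrop ll h) v2 (GList t (of_nat n - 1)) (SList w2) \<Longrightarrow>
    models h (VLoc ll) (GList t (of_nat n)) (SList (w1 # w2))"

text \<open>An undefined field contributes nothing to the footprint.\<close>

function footprint :: "heap \<Rightarrow> val \<Rightarrow> loc set" where
  "footprint h (VInt c) = {}"
| "footprint h VNull = {}"
| "footprint h (VLoc ll) =
     (case fmlookup h ll of
        None \<Rightarrow> {}
      | Some cl \<Rightarrow> {ll} \<union>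
          (case cl Hd of None \<Rightarrow> {} | Some v \<Rightarrow> footprint (fmdrop ll h) v) \<union>
          (case cl Tl of None \<Rightarrow> {} | Some v \<Rightarrow> footprint (fmdrop ll h) v))"
  by pat_completeness auto
termination
  by (relation "measure (\<lambda>(h, v). fcard (fmdom h))")
     (auto intro!: pfsubset_fcard_mono dest: fmdomI)

definition store_footprint :: "heap \<Rightarrow> store \<Rightarrow> loc set" where
  "store_footprint h s = (\<Union>v\<in>fmran' s. footprint h v)"

section \<open>Operational semantics\<close>

type_synonym closure = "fname \<rightharpoonup> var list \<times> exp"

fun binop_sem :: "binop \<Rightarrow> int \<Rightarrow> int \<Rightarrow> int" where
  "binop_sem Plus a b = a + b"
| "binop_sem Minus a b = a - b"
| "binop_sem Div a b = a div b"
| "binop_sem Mod a b = a mod b"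

inductive bigstep :: "store \<Rightarrow> heap \<Rightarrow> closure \<Rightarrow> exp \<Rightarrow> val \<Rightarrow> heap \<Rightarrow> bool" where
  B_Const: "bigstep s h \<C> (Basic (Const c)) (VInt c) h"
| B_Binop: "fmlookup s x = Some (VInt a) \<Longrightarrow> fmlookup s y = Some (VInt b) \<Longrightarrow>
    bigstep s h \<C> (Basic (Binop x bop y)) (VInt (binop_sem bop a b)) h"
| B_Nil: "bigstep s h \<C> (Basic ENil) VNull h"
| B_Var: "fmlookup s z = Some v \<Longrightarrow> bigstep s h \<C> (Basic (Var z)) v h"
| B_Cons: "fmlookup s zh = Some v1 \<Longrightarrow> fmlookup s zt = Some v2 \<Longrightarrow> fmlookup h ll = None \<Longrightarrow>
    bigstep s h \<C> (Basic (ECons zh zt)) (VLoc ll) (fmupd ll [Hd \<mapsto> v1, Tl \<mapsto> v2] h)"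
| B_IfTrue: "fmlookup s x = Some u \<Longrightarrow> u \<noteq> VInt 0 \<Longrightarrow> bigstep s h \<C> e1 v h' \<Longrightarrow>
    bigstep s h \<C> (IfThenElse x e1 e2) v h'"
| B_IfFalse: "fmlookup s x = Some (VInt 0) \<Longrightarrow> bigstep s h \<C> e2 v h' \<Longrightarrow>
    bigstep s h \<C> (IfThenElse x e1 e2) v h'"
| B_Let: "bigstep s h \<C> (Basic b) v1 h1 \<Longrightarrow> bigstep (fmupd z v1 s) h1 \<C> e v h' \<Longrightarrow>
    fmrestrict_set (store_footprint h (fmrestrict_set (FV e) s)) h =
    fmrestrict_set (store_footprint h (fmrestrict_set (FV e) s)) h1 \<Longrightarrow>
    bigstep s h \<C> (LetIn z b e) v h'"
| B_MatchNil: "fmlookup s l = Some VNull \<Longrightarrow> bigstep s h \<C> e1 v h' \<Longrightarrow>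
    bigstep s h \<C> (Match l e1 zh zt e2) v h'"
| B_MatchCons: "fmlookup s l = Some (VLoc ll) \<Longrightarrow> fmlookup h ll = Some cl \<Longrightarrow>
    cl Hd = Some v1 \<Longrightarrow> cl Tl = Some v2 \<Longrightarrow>
    bigstep (fmupd zt v2 (fmupd zh v1 s)) h \<C> e2 v h' \<Longrightarrow>
    bigstep s h \<C> (Match l e1 zh zt e2) v h'"
| B_LetFun: "bigstep s h (\<C>(f \<mapsto> (zs, e1))) e2 v h' \<Longrightarrow>
    bigstep s h \<C> (LetFun f zs e1 e2) v h'"
| B_FunApp: "\<C> f = Some (zs', ef) \<Longrightarrow> length zs' = length zs \<Longrightarrow> FV ef \<subseteq> set zs' \<Longrightarrow>
    map (fmlookup s) zs = map Some vs \<Longrightarrow>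
    bigstep (fmap_of_list (zip zs' vs)) h \<C> ef v h' \<Longrightarrow>
    bigstep s h \<C> (Basic (App f zs)) v h'"

section \<open>Instantiation of types\<close>

primrec inst :: "(tvar \<Rightarrow> gty) \<Rightarrow> (svar \<Rightarrow> nat) \<Rightarrow> zty \<Rightarrow> gty" where
  "inst \<eta> \<epsilon> TInt = GInt"
| "inst \<eta> \<epsilon> (TVar a) = \<eta> a"
| "inst \<eta> \<epsilon> (TList t p) = GList (inst \<eta> \<epsilon> t) (peval \<epsilon> p)"

end

theory Submission
  imports Defs "HOL-Computational_Algebra.Polynomial"
begin

text \<open>The proof is an induction on the evaluation, for arbitrary equations \<open>D\<close> that hold under the
  size valuation and for closures whose functions have the types given by the signature.
  The delicate case is the function call. A size variable of the formal types may be matched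
  with an expression whose value is not a natural number, because annotations inside an empty
  list are unconstrained, so the induction hypothesis does not apply to the matched valuation.
  It does apply with any natural number in place of such a value, and the returned value then has
  the result type for all of these choices. Since the heap determines the lengths of the returned
  lists, the relevant result annotations are polynomials that are constant on natural numbers, hence
  constant, and the returned value also has the result type at the matched valuation.\<close>

section \<open>Evaluation of size polynomials\<close>

text \<open>Points are rational because a size expression substituted for a size variable in a call
  need not take a natural value.\<close>

abbreviation reval :: "(svar \<Rightarrow> rat) \<Rightarrow> spoly \<Rightarrow> rat" where
  "reval \<equiv> insertion (\<lambda>c. c)"

section \<open>Evaluation as a ring homomorphism\<close>

definition monom_eval :: "(svar \<Rightarrow> 'r::comm_ring_1) \<Rightarrow> (svar \<Rightarrow>\<^sub>0 nat) \<Rightarrow> 'r" where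
  "monom_eval \<nu> m = (\<Prod>n\<in>Poly_Mapping.keys m. \<nu> n ^ Poly_Mapping.lookup m n)"

lemma monom_eval_superset:
  assumes "finite A" "Poly_Mapping.keys m \<subseteq> A"
  shows "monom_eval \<nu> m = (\<Prod>n\<in>A. \<nu> n ^ Poly_Mapping.lookup m n)"
  unfolding monom_eval_def using assms
  by (intro prod.mono_neutral_left) (auto simp: in_keys_iff)

lemma monom_eval_0 [simp]: "monom_eval \<nu> 0 = 1"
  by (simp add: monom_eval_def)

lemma monom_eval_add: "monom_eval \<nu> (m + m') = monom_eval \<nu> m * monom_eval \<nu> m'"
proof -
  let ?A = "Poly_Mapping.keys m \<union> Poly_Mapping.keys m'"
  have "Poly_Mapping.keys (m + m') \<subseteq> ?A"
    by (rule Poly_Mapping.keys_add)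
  then show ?thesis
    by (simp add: monom_eval_superset[of ?A] lookup_add power_add prod.distrib)
qed

lemma insertion_monom_eval:
  "insertion emb \<nu> p =
    (\<Sum>m\<in>Poly_Mapping.keys p. emb (Poly_Mapping.lookup p m) * monom_eval \<nu> m)"
  by (simp add: insertion_def monom_eval_def)

lemma reval_superset:
  assumes "finite A" "Poly_Mapping.keys p \<subseteq> A"
  shows "reval \<nu> p = (\<Sum>m\<in>A. Poly_Mapping.lookup p m * monom_eval \<nu> m)"
  unfolding insertion_monom_eval using assms
  by (intro sum.mono_neutral_left) (auto simp: in_keys_iff)

lemma reval_0 [simp]: "reval \<nu> 0 = 0"
  by (simp add: insertion_monom_eval)

lemma reval_add: "reval \<nu> (p + q) = reval \<nu> p + reval \<nu> q"
proof -
  let ?A = "Poly_Mapping.keys p \<union> Poly_Mapping.keys q"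
  have "Poly_Mapping.keys (p + q) \<subseteq> ?A"
    by (rule Poly_Mapping.keys_add)
  then show ?thesis
    by (simp add: reval_superset[of ?A] lookup_add distrib_right sum.distrib)
qed

lemma reval_diff: "reval \<nu> (p - q) = reval \<nu> p - reval \<nu> q"
  using reval_add[of \<nu> "p - q" q] by simp

lemma reval_sum: "reval \<nu> (\<Sum>i\<in>A. f i) = (\<Sum>i\<in>A. reval \<nu> (f i))"
  by (induction A rule: infinite_finite_induct) (auto simp: reval_add)

lemma reval_single: "reval \<nu> (Poly_Mapping.single m c) = c * monom_eval \<nu> m"
  by (subst reval_superset[of "{m}"]) auto

lemma sum_single_lookup:
  "(\<Sum>k\<in>Poly_Mapping.keys p. Poly_Mapping.single k (Poly_Mapping.lookup p k)) = p"
proof (rule poly_mapping_eqI)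
  fix k
  show "Poly_Mapping.lookup
      (\<Sum>k\<in>Poly_Mapping.keys p. Poly_Mapping.single k (Poly_Mapping.lookup p k)) k =
    Poly_Mapping.lookup p k"
    by (simp add: lookup_sum lookup_single when_def sum.delta in_keys_iff)
qed

text \<open>Multiplication of polynomials is a convolution of coefficients. Writing both factors as
  sums of monomials reduces the claim by bilinearity to two monomials, where
  \<open>monom_eval_add\<close> settles it.\<close>

lemma reval_mult: "reval \<nu> (p * q) = reval \<nu> p * reval \<nu> q"
proof -
  let ?s = "\<lambda>p. \<Sum>k\<in>Poly_Mapping.keys p. Poly_Mapping.single k (Poly_Mapping.lookup p k)"
  have "reval \<nu> (?s p * ?s q) = reval \<nu> (?s p) * reval \<nu> (?s q)"
    by (simp add: sum_product reval_sum mult_single reval_single monom_eval_add mult_ac)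
  then show ?thesis
    by (simp add: sum_single_lookup)
qed

lemma reval_1 [simp]: "reval \<nu> 1 = 1"
  using reval_single[of \<nu> 0 1] by simp

lemma reval_power: "reval \<nu> (p ^ k) = reval \<nu> p ^ k"
  by (induction k) (auto simp: reval_mult)

lemma reval_prod: "reval \<nu> (\<Prod>i\<in>A. f i) = (\<Prod>i\<in>A. reval \<nu> (f i))"
  by (induction A rule: infinite_finite_induct) (auto simp: reval_mult)

text \<open>Evaluation is a ring homomorphism sending \<open>pconst c\<close> to \<open>c\<close>,
  so it passes through the sums, products and powers that define \<open>psubst\<close>.\<close>

lemma reval_psubst: "reval \<nu> (psubst \<sigma> p) = reval (\<lambda>n. reval \<nu> (\<sigma> n)) p"
  unfolding psubst_def insertion_def[of pconst] insertion_def[of _ "\<lambda>n. reval \<nu> (\<sigma> n)"]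
  by (simp add: reval_sum reval_mult reval_prod reval_power reval_single pconst_def)

lemma peval_eq_reval: "peval \<epsilon> = reval (\<lambda>n. of_nat (\<epsilon> n))"
  by (simp add: peval_def)

lemma reval_pvar: "reval \<nu> (pvar n) = \<nu> n"
  by (simp add: pvar_def reval_single monom_eval_def)

lemma reval_cong: "(\<And>n. n \<in> pvars p \<Longrightarrow> \<nu> n = \<nu>' n) \<Longrightarrow> reval \<nu> p = reval \<nu>' p"
  unfolding insertion_def pvars_def
  by (intro sum.cong prod.cong arg_cong2[where f="(*)"] arg_cong2[where f="(^)"]) auto

lemma finite_pvars: "finite (pvars p)"
  by (simp add: pvars_def)

section \<open>Polynomials that are constant at natural points\<close>

lemma reval_univariate: "\<exists>P. \<forall>r. reval (\<nu>(x := r)) p = poly P r"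
proof -
  \<comment> \<open>Insertion into the ring of univariate polynomials, with \<open>x\<close> sent to
    the indeterminate and every other variable to a constant, yields the witness.\<close>
  let ?v = "\<lambda>n. if n = x then [:0, 1:] else [:\<nu> n:]"
  have "reval (\<nu>(x := r)) p = poly (insertion (\<lambda>c. [:c:]) ?v p) r" for r
    unfolding insertion_def poly_sum poly_mult poly_prod poly_power
    by (intro sum.cong prod.cong arg_cong2[where f="(*)"] arg_cong2[where f="(^)"]) auto
  then show ?thesis
    by blast
qed

text \<open>As a function of the coordinate \<open>x\<close> the value is a univariate polynomial.
  Minus \<open>c\<close> it vanishes at all natural numbers, and a nonzero polynomial has only
  finitely many roots.\<close>

lemma reval_const_if_const_on_nats:
  assumes "\<And>r. r \<in> \<nat> \<Longrightarrow> reval (\<nu>(x := r)) p = c"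
  shows "reval (\<nu>(x := r)) p = c"
proof -
  obtain P where P: "\<And>r. reval (\<nu>(x := r)) p = poly P r"
    using reval_univariate by blast
  have "\<nat> \<subseteq> {r. poly (P - [:c:]) r = 0}"
    using assms by (auto simp: P)
  moreover have "infinite (\<nat> :: rat set)"
    unfolding Nats_def by (rule range_inj_infinite) (simp add: inj_on_def)
  ultimately have "P - [:c:] = 0"
    using poly_roots_finite finite_subset by blast
  then show ?thesis
    by (simp add: P)
qed

text \<open>Coordinates are freed one at a time by \<open>reval_const_if_const_on_nats\<close>, in
  an induction on a finite set \<open>F\<close> of coordinates where the point may be
  non-natural.\<close>

lemma reval_const_if_const_on_nat_family:
  assumes nat: "\<And>\<nu>'. (\<And>n. \<nu>' n \<in> \<nat>) \<Longrightarrow> (\<And>n. \<nu> n \<in> \<nat> \<Longrightarrow> \<nu>' n = \<nu> n) \<Longrightarrow> reval \<nu>' p = c"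
  shows "reval \<nu> p = c"
proof -
  have *: "reval \<nu>' p = c"
    if "finite F" "\<And>n. n \<notin> F \<Longrightarrow> \<nu>' n \<in> \<nat>" "\<And>n. \<nu> n \<in> \<nat> \<Longrightarrow> \<nu>' n = \<nu> n" for F \<nu>'
    using that
  proof (induction F arbitrary: \<nu>' rule: finite_induct)
    case empty
    then show ?case
      by (intro nat) auto
  next
    case (insert x F)
    show ?case
    proof (cases "\<nu> x \<in> \<nat>")
      case True
      then show ?thesis
        using insert.prems by (intro insert.IH) (metis insert_iff)+
    next
      case False
      \<comment> \<open>As \<open>\<nu> x\<close> is not natural, agreement with
        \<open>\<nu>\<close> does not constrain \<open>x\<close>: any natural number may be put
        there, and the induction hypothesis for \<open>F\<close> applies.\<close>
      have "reval (\<nu>'(x := \<nu>' x)) p = c"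
      proof (rule reval_const_if_const_on_nats)
        fix r :: rat assume "r \<in> \<nat>"
        then show "reval (\<nu>'(x := r)) p = c"
          using False insert.prems by (intro insert.IH) auto
      qed
      then show ?thesis
        by simp
    qed
  qed
  \<comment> \<open>\<open>\<nu>\<close> may be non-natural at infinitely many variables; those
    outside \<open>p\<close> are reset to 0, so that the finite set \<open>pvars p\<close>
    suffices.\<close>
  let ?\<nu> = "\<lambda>n. if n \<in> pvars p \<or> \<nu> n \<in> \<nat> then \<nu> n else 0"
  have "reval ?\<nu> p = c"
    by (rule *[OF finite_pvars[of p]]) auto
  moreover have "reval ?\<nu> p = reval \<nu> p"
    by (rule reval_cong) simp
  ultimately show ?thesis
    by simp
qed

section \<open>Values of ground types\<close>

text \<open>The theorem only asks that some denotation exists, so the denoted value is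
  forgotten.\<close>

definition valid :: "heap \<Rightarrow> val \<Rightarrow> gty \<Rightarrow> bool" where
  "valid h v g \<longleftrightarrow> (\<exists>w. models h v g w)"

lemma models_GList_nat: "models h v (GList g q) w \<Longrightarrow> \<exists>m ws. q = of_nat m \<and> w = SList ws"
  by (erule models.cases) (auto intro: exI[of _ 0])

lemma valid_GList_nat: "valid h v (GList g q) \<Longrightarrow> q \<in> \<nat>"
  by (auto simp: valid_def dest: models_GList_nat)

lemma valid_GInt_iff: "valid h v GInt \<longleftrightarrow> (\<exists>c. v = VInt c)"
  by (auto simp: valid_def intro: models.intros elim: models.cases)

lemma valid_GList_0_iff: "valid h v (GList g 0) \<longleftrightarrow> v = VNull"
  by (auto simp: valid_def intro: models.intros elim: models.cases)

text \<open>The successor form serves inductions on the length; later proofs delete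
  \<open>of_nat_Suc\<close> from the simplifier to keep this form intact.\<close>

lemma valid_GList_Suc_iff:
  "valid h v (GList g (of_nat (Suc m))) \<longleftrightarrow>
    (\<exists>ll cl v1 v2. v = VLoc ll \<and> fmlookup h ll = Some cl \<and> cl Hd = Some v1 \<and> cl Tl = Some v2 \<and>
      valid (fmdrop ll h) v1 g \<and> valid (fmdrop ll h) v2 (GList g (of_nat m)))"
  (is "?L \<longleftrightarrow> ?R")
proof
  assume ?L
  then obtain w where "models h v (GList g (of_nat (Suc m))) w"
    by (auto simp: valid_def)
  then show ?R
  proof cases
    case models_Null
    then show ?thesis
      by (metis of_nat_eq_0_iff nat.distinct(1))
  next
    case (models_Loc n ll cl v1 v2 w1 w2)
    then have "n = Suc m"
      by (metis of_nat_eq_iff)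
    with models_Loc show ?thesis
      by (auto simp: valid_def)
  qed
next
  assume ?R
  then obtain ll cl v1 v2 w1 w2 where *: "v = VLoc ll" "fmlookup h ll = Some cl"
    "cl Hd = Some v1" "cl Tl = Some v2" "models (fmdrop ll h) v1 g w1"
    "models (fmdrop ll h) v2 (GList g (of_nat m)) w2"
    by (auto simp: valid_def)
  moreover obtain ws where "w2 = SList ws"
    using * models_GList_nat by blast
  ultimately have "models h v (GList g (of_nat (Suc m))) (SList (w1 # ws))"
    using models_Loc[of "Suc m" h ll cl v1 v2 g w1 ws] by simp
  then show ?L
    by (auto simp: valid_def)
qed

lemma valid_GList_VNull_iff: "valid h VNull (GList g q) \<longleftrightarrow> q = 0"
  by (auto simp: valid_def intro: models.intros elim: models.cases)

lemma valid_GList_VLocE: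
  assumes "valid h (VLoc ll) (GList g q)"
  obtains m cl v1 v2 where "q = of_nat (Suc m)" "fmlookup h ll = Some cl" "cl Hd = Some v1"
    "cl Tl = Some v2" "valid (fmdrop ll h) v1 g" "valid (fmdrop ll h) v2 (GList g (of_nat m))"
proof -
  obtain k where k: "q = of_nat k"
    using valid_GList_nat[OF assms] by (auto elim: Nats_cases)
  with assms show thesis
    by (cases k) (auto simp: valid_GList_0_iff valid_GList_Suc_iff simp del: of_nat_Suc intro: that)
qed

section \<open>Validity under changes of the heap\<close>

lemma valid_mono:
  assumes "valid h v g" and "\<And>x c. fmlookup h x = Some c \<Longrightarrow> fmlookup h1 x = Some c"
  shows "valid h1 v g"
proof -
  have "models h1 v g w" if "models h v g w" for w
    using that assms(2)
  proof (induction arbitrary: h1)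
    case (models_Loc n h ll cl v1 v2 t w1 w2)
    then show ?case
      by (intro models.models_Loc[of _ _ _ cl v1 v2] models_Loc.IH) (auto split: if_splits)
  qed (auto intro: models.intros)
  with assms show ?thesis
    by (auto simp: valid_def)
qed

text \<open>A derivation of \<open>models\<close> looks up only locations in the footprint. This
  turns the side condition of \<open>B_Let\<close> into validity in the heap left by the bound
  expression.\<close>

lemma valid_footprint_cong:
  assumes "valid h v g" and "\<And>x. x \<in> footprint h v \<Longrightarrow> fmlookup h1 x = fmlookup h x"
  shows "valid h1 v g"
proof -
  have "models h1 v g w" if "models h v g w" for w
    using that assms(2)
  proof (induction arbitrary: h1)
    case (models_Loc n h ll cl v1 v2 t w1 w2)
    then show ?case
      by (intro models.models_Loc[of _ _ _ cl v1 v2]) auto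
  qed (auto intro: models.intros)
  with assms show ?thesis
    by (auto simp: valid_def)
qed

text \<open>Elements are judged in heaps from which the preceding cells have been dropped, so the
  assumption has to cover all heaps.\<close>

lemma valid_GList_elem_mono:
  assumes "\<And>h v. valid h v g \<Longrightarrow> valid h v g'" and "valid h v (GList g q)"
  shows "valid h v (GList g' q)"
proof -
  obtain m where m: "q = of_nat m"
    using valid_GList_nat[OF assms(2)] by (auto elim: Nats_cases)
  from assms(2) show ?thesis
    unfolding m
  proof (induction m arbitrary: h v)
    case 0
    then show ?case
      by (simp add: valid_GList_0_iff)
  next
    case (Suc m)
    then show ?case
      using assms(1) by (simp only: valid_GList_Suc_iff) blast
  qed
qed

text \<open>The length is found by following the tails in the heap down to \<open>VNull\<close>; the
  element types do not influence it.\<close>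

lemma valid_GList_length_unique:
  assumes "valid h v (GList g q)" "valid h v (GList g' q')"
  shows "q = q'"
proof -
  obtain m m' where m: "q = of_nat m" "q' = of_nat m'"
    using assms[THEN valid_GList_nat] by (auto elim!: Nats_cases)
  from assms have "m = m'"
    unfolding m
  proof (induction m arbitrary: m' h v)
    case 0
    then show ?case
      by (cases m') (auto simp: valid_GList_0_iff valid_GList_Suc_iff simp del: of_nat_Suc)
  next
    case (Suc m)
    then show ?case
      by (cases m') (fastforce simp: valid_GList_0_iff valid_GList_Suc_iff simp del: of_nat_Suc)+
  qed
  with m show ?thesis
    by simp
qed

section \<open>Instantiation\<close>

text \<open>Ground types carry rational annotations, so instantiation makes sense at rational
  points; a list type of non-natural length is just uninhabited.\<close>

primrec rinst :: "(tvar \<Rightarrow> gty) \<Rightarrow> (svar \<Rightarrow> rat) \<Rightarrow> zty \<Rightarrow> gty" where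
  "rinst \<eta> \<nu> TInt = GInt"
| "rinst \<eta> \<nu> (TVar a) = \<eta> a"
| "rinst \<eta> \<nu> (TList t p) = GList (rinst \<eta> \<nu> t) (reval \<nu> p)"

lemma inst_eq_rinst: "inst \<eta> \<epsilon> t = rinst \<eta> (\<lambda>n. of_nat (\<epsilon> n)) t"
  by (induction t) (auto simp: peval_eq_reval)

lemma inst_tsubst:
  "inst \<eta> \<epsilon> (tsubst \<theta> \<sigma> t) = rinst (\<lambda>a. inst \<eta> \<epsilon> (\<theta> a)) (\<lambda>n. peval \<epsilon> (\<sigma> n)) t"
  by (induction t) (auto simp: peval_eq_reval reval_psubst)

lemma valid_ty_eq:
  assumes "ty_eq D t t'" "satisfies \<epsilon> D"
  shows "valid h v (inst \<eta> \<epsilon> t) \<longleftrightarrow> valid h v (inst \<eta> \<epsilon> t')"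
  using assms
proof (induction D t t' arbitrary: h v rule: ty_eq.induct)
  case (3 D t p t' p')
  have p: "peval \<epsilon> p = peval \<epsilon> p'"
    using 3 by (auto simp: entails_def)
  show ?case
  \<comment> \<open>At length 0 both types contain only \<open>VNull\<close>, whatever their element
    types. Otherwise the element types are equal under \<open>D\<close> and the induction hypothesis
    applies.\<close>
  proof (cases "entails D p 0")
    case True
    then have "peval \<epsilon> p = 0"
      using 3 by (auto simp: entails_def peval_eq_reval)
    with p show ?thesis
      by (simp add: valid_GList_0_iff)
  next
    case False
    then have "valid h v (inst \<eta> \<epsilon> t) = valid h v (inst \<eta> \<epsilon> t')" for h v
      using 3 by auto
    then show ?thesis
      unfolding inst.simps p by (intro iffI; elim valid_GList_elem_mono[rotated]; blast)
  qed
qed auto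

text \<open>Induction on the type. The heap fixes the length of a list, so its annotation has one
  value on the whole family, hence the same value at \<open>\<nu>\<close>. A second induction, on
  this length, reaches the elements.\<close>

lemma valid_rinst_of_nat_family:
  assumes "\<And>\<nu>'. (\<And>n. \<nu>' n \<in> \<nat>) \<Longrightarrow> (\<And>n. \<nu> n \<in> \<nat> \<Longrightarrow> \<nu>' n = \<nu> n) \<Longrightarrow> valid h v (rinst \<eta> \<nu>' t)"
  shows "valid h v (rinst \<eta> \<nu> t)"
proof -
  define N where "N = {\<nu>'. (\<forall>n. \<nu>' n \<in> \<nat>) \<and> (\<forall>n. \<nu> n \<in> \<nat> \<longrightarrow> \<nu>' n = \<nu> n)}"
  \<comment> \<open>The family is nonempty, with default 0 at the non-natural coordinates; one
    member is needed to read off lengths and cells.\<close>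
  have "(\<lambda>n. if \<nu> n \<in> \<nat> then \<nu> n else 0) \<in> N"
    by (auto simp: N_def)
  then obtain \<nu>0 where \<nu>0: "\<nu>0 \<in> N"
    by blast
  have "\<forall>\<nu>'\<in>N. valid h v (rinst \<eta> \<nu>' t)"
    using assms by (simp add: N_def)
  then show ?thesis
  proof (induction t arbitrary: h v)
    case (TList t p)
    then have prems: "valid h v (GList (rinst \<eta> \<nu>' t) (reval \<nu>' p))" if "\<nu>' \<in> N" for \<nu>'
      using that by simp
    have "reval \<nu>0 p \<in> \<nat>"
      using valid_GList_nat[OF prems[OF \<nu>0]] .
    then obtain m where m: "reval \<nu>0 p = of_nat m"
      by (auto elim: Nats_cases)
    have const: "reval \<nu>' p = of_nat m" if "\<nu>' \<in> N" for \<nu>'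
      using valid_GList_length_unique[OF prems[OF that] prems[OF \<nu>0]] m by simp
    then have \<nu>: "reval \<nu> p = of_nat m"
      by (rule reval_const_if_const_on_nat_family) (simp add: N_def)
    have "\<forall>\<nu>'\<in>N. valid h v (GList (rinst \<eta> \<nu>' t) (of_nat m))"
      using prems const by metis
    then have "valid h v (GList (rinst \<eta> \<nu> t) (of_nat m))"
    proof (induction m arbitrary: h v)
      case 0
      then show ?case
        using \<nu>0 by (auto simp: valid_GList_0_iff)
    next
      case (Suc m)
      obtain ll cl v1 v2 where c: "v = VLoc ll" "fmlookup h ll = Some cl" "cl Hd = Some v1"
        "cl Tl = Some v2"
        using Suc.prems \<nu>0 by (auto simp: valid_GList_Suc_iff simp del: of_nat_Suc)
      \<comment> \<open>The cell was obtained from \<open>\<nu>0\<close>, but the heap determines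
        it, so it serves all members of the family.\<close>
      have "\<forall>\<nu>'\<in>N. valid (fmdrop ll h) v1 (rinst \<eta> \<nu>' t) \<and>
          valid (fmdrop ll h) v2 (GList (rinst \<eta> \<nu>' t) (of_nat m))"
        using Suc.prems c by (auto simp: valid_GList_Suc_iff simp del: of_nat_Suc)
      then show ?case
        using c TList.IH Suc.IH unfolding valid_GList_Suc_iff by blast
    qed
    with \<nu> show ?case
      by simp
  qed (use \<nu>0 in auto)
qed

text \<open>A size variable matched with an expression of non-natural value can only occur inside an
  empty list, hence the freedom in the choice of \<open>\<nu>'\<close>.\<close>

lemma valid_formal_type:
  assumes "fits f t" "\<And>a u. (a, u) \<in> tvar_matches f t \<Longrightarrow> \<eta>' a = inst \<eta> \<epsilon> u"
    and "\<And>n p. (n, p) \<in> svar_matches f t \<Longrightarrow> peval \<epsilon> p \<in> \<nat> \<Longrightarrow> \<nu>' n = peval \<epsilon> p"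
    and "valid h v (inst \<eta> \<epsilon> t)"
  shows "valid h v (rinst \<eta>' \<nu>' (zty_of_aty f))"
  using assms
proof (induction f t arbitrary: h v rule: fits.induct)
  case (3 f n t p)
  have "peval \<epsilon> p \<in> \<nat>"
    using 3(5) by (auto dest: valid_GList_nat)
  then have "reval \<nu>' (pvar n) = peval \<epsilon> p"
    using 3 by (simp add: reval_pvar)
  moreover have "valid h v (rinst \<eta>' \<nu>' (zty_of_aty f))" if "valid h v (inst \<eta> \<epsilon> t)" for h v
    using 3 that by auto
  ultimately show ?case
    using 3(5) by (auto elim: valid_GList_elem_mono[rotated])
qed auto

section \<open>Soundness\<close>

text \<open>Bodies are required to be typable rather than semantically sound: soundness of recursive
  calls then comes from the induction on the evaluation.\<close>

definition closure_typed :: "sig \<Rightarrow> closure \<Rightarrow> bool" where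
  "closure_typed \<Sigma> \<C> \<longleftrightarrow>
    (\<forall>f zs e. \<C> f = Some (zs, e) \<longrightarrow>
      (\<exists>fs t. \<Sigma> f = Some (fs, t) \<and> length zs = length fs \<and> distinct zs \<and>
        typing \<Sigma> [] (map_of (zip zs (map zty_of_aty fs))) e t))"

text \<open>Validity is relative to a set of variables because \<open>B_Let\<close> preserves only
  the footprint of variables free in the body.\<close>

definition store_valid ::
  "(tvar \<Rightarrow> gty) \<Rightarrow> (svar \<Rightarrow> nat) \<Rightarrow> var set \<Rightarrow> heap \<Rightarrow> store \<Rightarrow> ctxt \<Rightarrow> bool" where
  "store_valid \<eta> \<epsilon> V h s \<Gamma> \<longleftrightarrow>
    (\<forall>z\<in>V. \<exists>u t. fmlookup s z = Some u \<and> \<Gamma> z = Some t \<and> valid h u (inst \<eta> \<epsilon> t))"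

lemma store_validD:
  "store_valid \<eta> \<epsilon> V h s \<Gamma> \<Longrightarrow> z \<in> V \<Longrightarrow> fmlookup s z = Some u \<Longrightarrow> \<Gamma> z = Some t \<Longrightarrow>
    valid h u (inst \<eta> \<epsilon> t)"
  by (fastforce simp: store_valid_def)

lemma store_valid_subset: "store_valid \<eta> \<epsilon> V h s \<Gamma> \<Longrightarrow> U \<subseteq> V \<Longrightarrow> store_valid \<eta> \<epsilon> U h s \<Gamma>"
  by (auto simp: store_valid_def)

inductive_cases typing_ConstE: "typing \<Sigma> D \<Gamma> (Basic (Const c)) t"
inductive_cases typing_BinopE: "typing \<Sigma> D \<Gamma> (Basic (Binop x bop y)) t"
inductive_cases typing_NilE: "typing \<Sigma> D \<Gamma> (Basic ENil) t"
inductive_cases typing_VarE: "typing \<Sigma> D \<Gamma> (Basic (Var z)) t"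
inductive_cases typing_ConsE: "typing \<Sigma> D \<Gamma> (Basic (ECons zh zt)) t"
inductive_cases typing_AppE: "typing \<Sigma> D \<Gamma> (Basic (App f zs)) t"
inductive_cases typing_IfE: "typing \<Sigma> D \<Gamma> (IfThenElse x e1 e2) t"
inductive_cases typing_LetE: "typing \<Sigma> D \<Gamma> (LetIn z b e) t"
inductive_cases typing_MatchE: "typing \<Sigma> D \<Gamma> (Match l e1 zh zt e2) t"
inductive_cases typing_LetFunE: "typing \<Sigma> D \<Gamma> (LetFun f zs e1 e2) t"

text \<open>This supplies the store hypothesis for the body of a called function, by
  \<open>valid_formal_type\<close> at each argument position.\<close>

lemma store_valid_formals:
  assumes "Theta fs ts \<theta> \<sigma> C" "\<And>p q. (p, q) \<in> C \<Longrightarrow> peval \<epsilon> p = peval \<epsilon> q"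
    and "length zs = length fs" "distinct zs" "list_all2 (\<lambda>v t. valid h v (inst \<eta> \<epsilon> t)) vs ts"
    and \<epsilon>': "\<And>n. peval \<epsilon> (\<sigma> n) \<in> \<nat> \<Longrightarrow> of_nat (\<epsilon>' n) = peval \<epsilon> (\<sigma> n)"
  shows "store_valid (\<lambda>a. inst \<eta> \<epsilon> (\<theta> a)) \<epsilon>' (set zs) h (fmap_of_list (zip zs vs))
    (map_of (zip zs (map zty_of_aty fs)))"
  unfolding store_valid_def
proof
  fix z assume "z \<in> set zs"
  then obtain i where i: "i < length zs" "z = zs ! i"
    by (auto simp: in_set_conv_nth)
  have fits: "list_all2 fits fs ts"
    using assms(1) by (simp add: Theta_def)
  have len: "length fs = length ts" "length vs = length ts"
    using fits assms(5) by (auto dest: list_all2_lengthD)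
  have mem: "(fs ! i, ts ! i) \<in> set (zip fs ts)"
    using i len assms(3) by (auto simp: in_set_zip)
  have tm: "\<theta> a = u" if "(a, u) \<in> tvar_matches (fs ! i) (ts ! i)" for a u
    using assms(1) mem that by (fastforce simp: Theta_def Let_def)
  \<comment> \<open>\<open>\<sigma> n\<close> is itself one of the expressions matched with
    \<open>n\<close>, and \<open>C\<close> equates all of these.\<close>
  have sm: "peval \<epsilon> (\<sigma> n) = peval \<epsilon> p" if p: "(n, p) \<in> svar_matches (fs ! i) (ts ! i)" for n p
  proof -
    let ?SM = "\<Union>(f, t)\<in>set (zip fs ts). svar_matches f t"
    have "(n, p) \<in> ?SM"
      using p mem by blast
    moreover from this have "(n, \<sigma> n) \<in> ?SM"
      using assms(1) unfolding Theta_def Let_def by (meson DomainI)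
    ultimately have "(\<sigma> n, p) \<in> C"
      using assms(1) unfolding Theta_def Let_def by blast
    then show ?thesis
      by (rule assms(2))
  qed
  have "valid h (vs ! i) (rinst (\<lambda>a. inst \<eta> \<epsilon> (\<theta> a)) (\<lambda>n. of_nat (\<epsilon>' n)) (zty_of_aty (fs ! i)))"
  proof (rule valid_formal_type)
    show "fits (fs ! i) (ts ! i)"
      using fits i assms(3) by (auto dest: list_all2_nthD)
    show "valid h (vs ! i) (inst \<eta> \<epsilon> (ts ! i))"
      using assms(3,5) i len by (auto dest: list_all2_nthD)
  next
    fix a u assume "(a, u) \<in> tvar_matches (fs ! i) (ts ! i)"
    then show "inst \<eta> \<epsilon> (\<theta> a) = inst \<eta> \<epsilon> u"
      using tm by blast
  next
    fix n p assume "(n, p) \<in> svar_matches (fs ! i) (ts ! i)" "peval \<epsilon> p \<in> \<nat>"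
    then show "of_nat (\<epsilon>' n) = peval \<epsilon> p"
      using sm \<epsilon>' by metis
  qed
  moreover have "fmlookup (fmap_of_list (zip zs vs)) z = Some (vs ! i)"
    using i len assms(3,4) by (simp add: fmlookup_of_list map_of_zip_nth)
  moreover have "map_of (zip zs (map zty_of_aty fs)) z = Some (zty_of_aty (fs ! i))"
    using i len assms(3,4) by (simp add: map_of_zip_nth)
  ultimately show "\<exists>u t. fmlookup (fmap_of_list (zip zs vs)) z = Some u \<and>
      map_of (zip zs (map zty_of_aty fs)) z = Some t \<and>
      valid h u (inst (\<lambda>a. inst \<eta> \<epsilon> (\<theta> a)) \<epsilon>' t)"
    unfolding inst_eq_rinst[of _ \<epsilon>'] by blast
qed

text \<open>Everything on the typing side varies in the induction except the signature: the nil
  branch of a match adds an equation, and a call switches to the context, valuation and type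
  instantiation of the callee. \<open>LetExtern\<close> has no evaluation rule and thus no
  case.\<close>

theorem typing_sound:
  assumes "bigstep s h \<C> e v h'" "closure_typed \<Sigma> \<C>" "typing \<Sigma> D \<Gamma> e \<tau>" "satisfies \<epsilon> D"
    and "store_valid \<eta> \<epsilon> (FV e) h s \<Gamma>"
  shows "valid h' v (inst \<eta> \<epsilon> \<tau>)"
  using assms
proof (induction arbitrary: D \<Gamma> \<tau> \<epsilon> \<eta> rule: bigstep.induct)
  case (B_Const s h \<C> c)
  then show ?case
    by (auto elim!: typing_ConstE simp: valid_GInt_iff)
next
  case (B_Binop s x a y b h \<C> bop)
  then show ?case
    by (auto elim!: typing_BinopE simp: valid_GInt_iff)
next
  case (B_Nil s h \<C>)
  then show ?case
    by (auto elim!: typing_NilE simp: valid_GList_VNull_iff entails_def peval_eq_reval)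
next
  case (B_Var s z v h \<C>)
  from B_Var(3) obtain t where t: "\<Gamma> z = Some t" "ty_eq D t \<tau>"
    by (auto elim!: typing_VarE)
  then have "valid h v (inst \<eta> \<epsilon> t)"
    using B_Var by (auto intro: store_validD)
  then show ?case
    using t B_Var valid_ty_eq by blast
next
  case (B_Cons s zh v1 zt v2 h ll \<C>)
  from B_Cons(5) obtain t p p' where t: "\<Gamma> zh = Some t" "\<Gamma> zt = Some (TList t p')"
    "entails D p (p' + 1)" "\<tau> = TList t p"
    by (auto elim!: typing_ConsE)
  have v1: "valid h v1 (inst \<eta> \<epsilon> t)" and v2: "valid h v2 (GList (inst \<eta> \<epsilon> t) (peval \<epsilon> p'))"
    using B_Cons(1,2) t store_validD[OF B_Cons(7), of zh v1 t]
      store_validD[OF B_Cons(7), of zt v2 "TList t p'"] by auto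
  obtain m where m: "peval \<epsilon> p' = of_nat m"
    using valid_GList_nat[OF v2] by (auto elim: Nats_cases)
  have "peval \<epsilon> p = of_nat (Suc m)"
    using t B_Cons m by (auto simp: entails_def peval_eq_reval reval_add)
  \<comment> \<open>The cell is fresh, so dropping it returns the old heap, in which head and tail
    are known to be valid.\<close>
  moreover have "fmdrop ll (fmupd ll [Hd \<mapsto> v1, Tl \<mapsto> v2] h) = h"
    using B_Cons by (intro fmap_ext) auto
  ultimately show ?case
    using t v1 v2 m by (auto simp: valid_GList_Suc_iff simp del: of_nat_Suc)
next
  case (B_IfTrue s x u h \<C> e1 v h' e2)
  from B_IfTrue.prems show ?case
    by (auto elim!: typing_IfE intro!: B_IfTrue.IH elim: store_valid_subset)
next
  case (B_IfFalse s x h \<C> e2 v h' e1)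
  from B_IfFalse.prems show ?case
    by (auto elim!: typing_IfE intro!: B_IfFalse.IH elim: store_valid_subset)
next
  case (B_Let s h \<C> b v1 h1 z e v h')
  from B_Let.prems(2) obtain tz where t: "typing \<Sigma> D \<Gamma> (Basic b) tz"
    "typing \<Sigma> D (\<Gamma>(z \<mapsto> tz)) e \<tau>"
    by (auto elim!: typing_LetE)
  have v1: "valid h1 v1 (inst \<eta> \<epsilon> tz)"
    using B_Let.prems t by (intro B_Let.IH(1)) (auto intro: store_valid_subset)
  let ?R = "store_footprint h (fmrestrict_set (FV e) s)"
  have agree: "fmlookup h1 x = fmlookup h x" if "x \<in> ?R" for x
    using that arg_cong[OF B_Let.hyps(3), of "\<lambda>h. fmlookup h x"] by simp
  have "store_valid \<eta> \<epsilon> (FV e) h1 (fmupd z v1 s) (\<Gamma>(z \<mapsto> tz))"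
    unfolding store_valid_def
  proof
    fix y assume y: "y \<in> FV e"
    show "\<exists>u t. fmlookup (fmupd z v1 s) y = Some u \<and> (\<Gamma>(z \<mapsto> tz)) y = Some t \<and>
        valid h1 u (inst \<eta> \<epsilon> t)"
    proof (cases "y = z")
      case True
      with v1 show ?thesis
        by simp
    next
      case False
      with y B_Let.prems(4) obtain u t where u: "fmlookup s y = Some u" "\<Gamma> y = Some t"
        "valid h u (inst \<eta> \<epsilon> t)"
        unfolding store_valid_def FV.simps by blast
      \<comment> \<open>As \<open>y\<close> is free in the body, the side condition of the let
        protects the footprint of its value.\<close>
      have "footprint h u \<subseteq> ?R"
        unfolding store_footprint_def using u y
        by (intro UN_upper fmran'I[of _ y]) simp
      then have "valid h1 u (inst \<eta> \<epsilon> t)"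
        using u agree by (auto intro: valid_footprint_cong)
      with u False show ?thesis
        by simp
    qed
  qed
  with B_Let.prems t show ?case
    by (intro B_Let.IH(2))
next
  case (B_MatchNil s l h \<C> e1 v h' zh zt e2)
  from B_MatchNil.prems(2) obtain t' p where t: "\<Gamma> l = Some (TList t' p)"
    "typing \<Sigma> ((p, 0) # D) \<Gamma> e1 \<tau>"
    by (auto elim!: typing_MatchE)
  have "valid h VNull (inst \<eta> \<epsilon> (TList t' p))"
    using B_MatchNil t by (auto intro: store_validD simp del: inst.simps)
  \<comment> \<open>Validity of \<open>VNull\<close> forces \<open>p\<close> to evaluate to 0, which
    is the equation added for the nil branch.\<close>
  then have "satisfies \<epsilon> ((p, 0) # D)"
    using B_MatchNil.prems by (auto simp: valid_GList_VNull_iff satisfies_def peval_eq_reval)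
  with B_MatchNil.prems t show ?case
    by (intro B_MatchNil.IH[of "(p, 0) # D" \<Gamma>]) (auto elim: store_valid_subset)
next
  case (B_MatchCons s l ll h cl v1 v2 zt zh \<C> e2 v h' e1)
  from B_MatchCons.prems(2) obtain t' p where t: "\<Gamma> l = Some (TList t' p)"
    "zh \<noteq> zt" "typing \<Sigma> D (\<Gamma>(zh \<mapsto> t', zt \<mapsto> TList t' (p - 1))) e2 \<tau>"
    by (auto elim!: typing_MatchE)
  have "valid h (VLoc ll) (inst \<eta> \<epsilon> (TList t' p))"
    using B_MatchCons t by (auto intro: store_validD simp del: inst.simps)
  then obtain m where m: "peval \<epsilon> p = of_nat (Suc m)" "valid (fmdrop ll h) v1 (inst \<eta> \<epsilon> t')"
    "valid (fmdrop ll h) v2 (GList (inst \<eta> \<epsilon> t') (of_nat m))"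
    using B_MatchCons.hyps by (auto elim: valid_GList_VLocE)
  have "peval \<epsilon> (p - 1) = of_nat m"
    using m by (simp add: peval_eq_reval reval_diff)
  \<comment> \<open>The fields are valid in the heap without the cell; the branch runs in the larger
    heap \<open>h\<close>.\<close>
  moreover have "valid h v1 (inst \<eta> \<epsilon> t')" "valid h v2 (GList (inst \<eta> \<epsilon> t') (of_nat m))"
    using m(2,3) by (auto elim!: valid_mono split: if_splits)
  ultimately have "store_valid \<eta> \<epsilon> (FV e2) h (fmupd zt v2 (fmupd zh v1 s))
      (\<Gamma>(zh \<mapsto> t', zt \<mapsto> TList t' (p - 1)))"
    using B_MatchCons.prems(4) t(2) by (auto simp: store_valid_def)
  with B_MatchCons.prems t show ?case
    by (intro B_MatchCons.IH[of D])
next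
  case (B_LetFun s h \<C> f zs e1 e2 v h')
  from B_LetFun.prems(2) obtain fs t where t: "\<Sigma> f = Some (fs, t)" "length zs = length fs"
    "distinct zs" "typing \<Sigma> [] (map_of (zip zs (map zty_of_aty fs))) e1 t" "typing \<Sigma> D \<Gamma> e2 \<tau>"
    by (auto elim!: typing_LetFunE)
  then have "closure_typed \<Sigma> (\<C>(f \<mapsto> (zs, e1)))"
    using B_LetFun.prems(1) by (auto simp: closure_typed_def)
  with B_LetFun.prems t show ?case
    by (intro B_LetFun.IH[of D \<Gamma>]) (auto elim: store_valid_subset simp del: fun_upd_apply)
next
  case (B_FunApp \<C> f zs' ef zs s vs h v h')
  from B_FunApp.prems(2) obtain fs t ts \<theta> \<sigma> C where t: "\<Sigma> f = Some (fs, t)"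
    "map \<Gamma> zs = map Some ts" "Theta fs ts \<theta> \<sigma> C" "ty_eq D \<tau> (tsubst \<theta> \<sigma> t)"
    "\<forall>(p, q)\<in>C. entails D p q"
    by (auto elim!: typing_AppE)
  have ef: "length zs' = length fs" "distinct zs'"
    "typing \<Sigma> [] (map_of (zip zs' (map zty_of_aty fs))) ef t"
    using B_FunApp.prems(1) B_FunApp.hyps(1) t(1) by (fastforce simp: closure_typed_def)+
  have C: "peval \<epsilon> p = peval \<epsilon> q" if "(p, q) \<in> C" for p q
    using t(5) that B_FunApp.prems(3) by (auto simp: entails_def)
  have len: "length vs = length zs" "length ts = length zs"
    using map_eq_imp_length_eq[OF B_FunApp.hyps(4)] map_eq_imp_length_eq[OF t(2)] by auto
  have args: "list_all2 (\<lambda>v t. valid h v (inst \<eta> \<epsilon> t)) vs ts"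
    unfolding list_all2_conv_all_nth
  proof (intro conjI allI impI)
    fix i assume "i < length vs"
    then have i: "i < length zs"
      using len by simp
    have "fmlookup s (zs ! i) = Some (vs ! i)" "\<Gamma> (zs ! i) = Some (ts ! i)"
      using i len arg_cong[OF B_FunApp.hyps(4), of "\<lambda>xs. xs ! i"]
        arg_cong[OF t(2), of "\<lambda>xs. xs ! i"] by auto
    with i show "valid h (vs ! i) (inst \<eta> \<epsilon> (ts ! i))"
      by (intro store_validD[OF B_FunApp.prems(4)]) auto
  qed (use len in simp)
  let ?\<eta> = "\<lambda>a. inst \<eta> \<epsilon> (\<theta> a)" and ?\<nu> = "\<lambda>n. peval \<epsilon> (\<sigma> n)"
  have "valid h' v (rinst ?\<eta> ?\<nu> t)"
  proof (rule valid_rinst_of_nat_family)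
    fix \<nu>' :: "svar \<Rightarrow> rat"
    assume nat: "\<And>n. \<nu>' n \<in> \<nat>" and eq: "\<And>n. ?\<nu> n \<in> \<nat> \<Longrightarrow> \<nu>' n = ?\<nu> n"
    have "\<forall>n. \<exists>k. \<nu>' n = of_nat k"
      using nat by (auto elim: Nats_cases)
    then obtain \<epsilon>' where \<epsilon>': "\<nu>' = (\<lambda>n. of_nat (\<epsilon>' n))"
      by metis
    have "store_valid ?\<eta> \<epsilon>' (set zs') h (fmap_of_list (zip zs' vs))
        (map_of (zip zs' (map zty_of_aty fs)))"
      using eq by (intro store_valid_formals[OF t(3) C ef(1,2) args]) (auto simp: \<epsilon>')
    \<comment> \<open>The body is typed under no equations, so every choice of
      \<open>\<epsilon>'\<close> satisfies them and the induction hypothesis is available at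
      each.\<close>
    then have "valid h' v (inst ?\<eta> \<epsilon>' t)"
      using B_FunApp.hyps(3) B_FunApp.prems(1) ef(3)
      by (intro B_FunApp.IH[of "[]" "map_of (zip zs' (map zty_of_aty fs))"])
        (auto elim: store_valid_subset simp: satisfies_def)
    then show "valid h' v (rinst ?\<eta> \<nu>' t)"
      by (simp add: inst_eq_rinst[of _ \<epsilon>'] \<epsilon>')
  qed
  then show ?case
    using valid_ty_eq[OF t(4) B_FunApp.prems(3)] by (simp add: inst_tsubst)
qed

theorem theorem3p1:
  fixes e :: exp and s :: store and h h' :: heap and v :: val
  assumes "wf_exp e"
    and "bigstep s h Map.empty e v h'"
    and "called e \<subseteq> letfun_defined e"
  shows "\<forall>(\<Gamma> :: ctxt) (\<Sigma> :: sig) (\<tau> :: zty). signature \<Sigma> \<and> typing \<Sigma> [] \<Gamma> e \<tau> \<longrightarrow>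
    (\<forall>(\<epsilon> :: svar \<Rightarrow> nat) (\<eta> :: tvar \<Rightarrow> gty).
      (\<forall>z\<in>FV e. \<exists>u \<tau>' w. fmlookup s z = Some u \<and> \<Gamma> z = Some \<tau>' \<and>
         models h u (inst \<eta> \<epsilon> \<tau>') w) \<longrightarrow>
      (\<exists>w'. models h' v (inst \<eta> \<epsilon> \<tau>) w'))"
proof (intro allI impI, elim conjE)
  fix \<Gamma> :: ctxt and \<Sigma> :: sig and \<tau> :: zty and \<epsilon> :: "svar \<Rightarrow> nat" and \<eta> :: "tvar \<Rightarrow> gty"
  assume "typing \<Sigma> [] \<Gamma> e \<tau>"
    and "\<forall>z\<in>FV e. \<exists>u \<tau>' w. fmlookup s z = Some u \<and> \<Gamma> z = Some \<tau>' \<and>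
      models h u (inst \<eta> \<epsilon> \<tau>') w"
  then have "valid h' v (inst \<eta> \<epsilon> \<tau>)"
    using assms(2)
    by (intro typing_sound[of s h Map.empty e v h' \<Sigma> "[]" \<Gamma>])
      (auto simp: closure_typed_def satisfies_def store_valid_def valid_def)
  then show "\<exists>w'. models h' v (inst \<eta> \<epsilon> \<tau>) w'"
    by (simp add: valid_def)
qed

end
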